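(* Let $n\ge 2$ and $C_\ell\ge 1$ be integers, let $h=1/n$, $N_h=(n-1)^2$, and let $G_h=(\mathcal{V}_h,E_h)$ be the finite element connectivity graph (on $N_h$ vertices) with connectivity level $C_\ell$ defined in the context. Let $M\in\mathrm{GL}_{N_h}(\mathbb{R})$ be an invertible matrix, and let $K\subset\mathbb{R}^{N_h}$ be a nonempty compact set. Then there exists a ReLU neural network $\mathcal{N}:\mathbb{R}^{N_h}\to\mathbb{R}^{N_h}$ whose weight matrices are all $G_h$-sparse and which satisfies $$\mathcal{N}(x)=Mx\quad\text{for all }x\in K.$$
   Context: Mesh and basis functions: On the unit square $(0,1)^2$ take the uniform Cartesian grid with spacing $h=1/n$ and nodes $\eta_{i,j}=(ih,jh)$, $0\le i,j\le n$. Each grid square is split into two right isosceles triangles by cutting along its diagonal from the top-left to the bottom-right corner (the same direction in all squares). The interior node index set is $\mathcal{V}_h=\{(i,j):1\le i,j\le n-1\}$, with $N_h=|\mathcal{V}_h|=(n-1)^2$; it is identified with $\{1,\dots,N_h\}$ via $(i,j)\mapsto (n-1)(j-1)+i$. For $(i,j)\in\mathcal{V}_h$, $\phi_{i,j}$ is the continuous piecewise linear nodal ("hat") basis function equal to $1$ at $\eta_{i,j}$ and $0$ at all other nodes. $|\cdot|$ denotes Lebesgue measure of a planar set. Patches and neighborhoods: $\mathcal{P}^{(1)}_{i,j}=\mathrm{supp}(\phi_{i,j})$, and for $t\ge1$, $\mathcal{P}^{(t+1)}_{i,j}=\bigcup\{\mathrm{supp}(\phi_{p,q}) : (p,q)\in\mathcal{V}_h,\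 |\mathrm{supp}(\phi_{p,q})\cap\mathcal{P}^{(t)}_{i,j}|\neq0\}$. The level-$t$ neighborhood is $\mathcal{V}_t(i,j)=\{(p,q)\in\mathcal{V}_h : |\mathrm{supp}(\phi_{p,q})\cap\mathcal{P}^{(t)}_{i,j}|\neq 0\}$. Graph $G_h$: the simple undirected graph with vertex set $\mathcal{V}_h$ in which two distinct vertices $(i,j)$ and $(p,q)$ are adjacent if and only if $(p,q)\in\mathcal{V}_{C_\ell}(i,j)$. $G$-sparse matrices: for a simple undirected graph $G=(V,E)$ with $V$ identified with $\{1,\dots,N\}$, a matrix $W=(w_{ij})\in M_N(\mathbb{R})$ is $G$-sparse if for all $i\ne j$, $w_{ij}\neq 0$ implies $\{i,j\}\in E$ (diagonal entries are unrestricted). Networks: for an activation $\sigma:\mathbb{R}\to\mathbb{R}$ (applied componentwise), a $\sigma$-network $\mathbb{R}^{N}\to\mathbb{R}^{N}$ with all layers of width $N$ is a finite composition $A_{L}\circ\sigma\circ A_{L-1}\circ\cdots\circ\sigma\circ A_1$ of affine maps $A_\ell(z)=W^{(\ell)}z+b^{(\ell)}$ with weight matrices $W^{(\ell)}\in\mathbb{R}^{N\times N}$ and biases $b^{(\ell)}\in\mathbb{R}^N$; the last layer is affine, with no activation. A ReLU network is a $\sigma$-network with $\sigma(t)=\max\{t,0\}$. *)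

theory Defs
  imports
    "HOL-Analysis.Analysis"
    "Jordan_Normal_Form.Gauss_Jordan_Elimination"
    "Jordan_Normal_Form.Determinant"
begin

section \<open>Mesh and nodal basis\<close>

definition unit_square :: "(real \<times> real) set" where
  "unit_square = {0..1} \<times> {0..1}"

definition grid_node :: "nat \<Rightarrow> nat \<times> nat \<Rightarrow> real \<times> real" where
  "grid_node n v = (real (fst v) / real n, real (snd v) / real n)"

definition lower_triangle :: "nat \<Rightarrow> nat \<Rightarrow> nat \<Rightarrow> (real \<times> real) set" where
  "lower_triangle n a b =
     convex hull {grid_node n (a, b), grid_node n (a + 1, b), grid_node n (a, b + 1)}"

definition upper_triangle :: "nat \<Rightarrow> nat \<Rightarrow> nat \<Rightarrow> (real \<times> real) set" where
  "upper_triangle n a b =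
     convex hull {grid_node n (a + 1, b + 1), grid_node n (a + 1, b), grid_node n (a, b + 1)}"

definition mesh_triangles :: "nat \<Rightarrow> (real \<times> real) set set" where
  "mesh_triangles n = (\<Union>a\<in>{..<n}. \<Union>b\<in>{..<n}. {lower_triangle n a b, upper_triangle n a b})"

definition interior_nodes :: "nat \<Rightarrow> (nat \<times> nat) set" where
  "interior_nodes n = {1..n - 1} \<times> {1..n - 1}"

(* Functions on the closed unit square are represented by their extension by 0 to the plane. *)
definition nodal_function :: "nat \<Rightarrow> nat \<times> nat \<Rightarrow> (real \<times> real \<Rightarrow> real) \<Rightarrow> bool" where
  "nodal_function n v f \<longleftrightarrow>
     continuous_on unit_square f \<and>
     (\<forall>T\<in>mesh_triangles n. \<exists>c d. \<forall>z\<in>T. f z = c + inner d z) \<and>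
     (\<forall>i\<le>n. \<forall>j\<le>n. f (grid_node n (i, j)) = (if (i, j) = v then 1 else 0)) \<and>
     (\<forall>z. z \<notin> unit_square \<longrightarrow> f z = 0)"

(* Well defined for interior nodes: see ex1_nodal_function below. *)
definition hat :: "nat \<Rightarrow> nat \<times> nat \<Rightarrow> real \<times> real \<Rightarrow> real" where
  "hat n v = (THE f. nodal_function n v f)"

definition hat_supp :: "nat \<Rightarrow> nat \<times> nat \<Rightarrow> (real \<times> real) set" where
  "hat_supp n v = closure {z. hat n v z \<noteq> 0}"


section \<open>Patches, neighborhoods and the connectivity graph\<close>

(* Levels start at 1; level 0 is a dummy value. *)
fun patch :: "nat \<Rightarrow> nat \<Rightarrow> nat \<times> nat \<Rightarrow> (real \<times> real) set" where
  "patch n 0 v = {}"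
| "patch n (Suc 0) v = hat_supp n v"
| "patch n (Suc (Suc t)) v =
     \<Union> {hat_supp n w | w. w \<in> interior_nodes n \<and>
                        emeasure lebesgue (hat_supp n w \<inter> patch n (Suc t) v) \<noteq> 0}"

definition neighborhood :: "nat \<Rightarrow> nat \<Rightarrow> nat \<times> nat \<Rightarrow> (nat \<times> nat) set" where
  "neighborhood n t v =
     {w \<in> interior_nodes n. emeasure lebesgue (hat_supp n w \<inter> patch n t v) \<noteq> 0}"

(* The neighborhood relation is symmetric on interior nodes, so that {v, w} is an edge iff
   w is in the neighborhood of v: see fe_edges_iff below. *)
definition fe_edges :: "nat \<Rightarrow> nat \<Rightarrow> (nat \<times> nat) set set" where
  "fe_edges n C =
     {{v, w} | v w. v \<in> interior_nodes n \<and> w \<in> interior_nodes n \<and> v \<noteq> w \<and> w \<in> neighborhood n C v}"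

definition node_index :: "nat \<Rightarrow> nat \<times> nat \<Rightarrow> nat" where
  "node_index n v = (n - 1) * (snd v - 1) + fst v"


section \<open>Sparse matrices and networks\<close>

(* idx identifies V with {1..card V}; matrix entries are indexed from 0. *)
definition graph_sparse :: "'v set \<Rightarrow> 'v set set \<Rightarrow> ('v \<Rightarrow> nat) \<Rightarrow> real mat \<Rightarrow> bool" where
  "graph_sparse V E idx W \<longleftrightarrow>
     W \<in> carrier_mat (card V) (card V) \<and>
     (\<forall>u\<in>V. \<forall>v\<in>V. u \<noteq> v \<longrightarrow> W $$ (idx u - 1, idx v - 1) \<noteq> 0 \<longrightarrow> {u, v} \<in> E)"

(* A layer is a pair of a weight matrix and a bias; the first list element is applied first.
   The empty list is not a network and is excluded in network_layers. *)
fun network_fun :: "(real \<Rightarrow> real) \<Rightarrow> (real mat \<times> real vec) list \<Rightarrow> real vec \<Rightarrow> real vec" where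
  "network_fun \<sigma> [] x = x"
| "network_fun \<sigma> [(W, b)] x = W *\<^sub>v x + b"
| "network_fun \<sigma> ((W, b) # l # ls) x = network_fun \<sigma> (l # ls) (map_vec \<sigma> (W *\<^sub>v x + b))"

definition network_layers :: "nat \<Rightarrow> (real mat \<times> real vec) list \<Rightarrow> bool" where
  "network_layers N ls \<longleftrightarrow>
     ls \<noteq> [] \<and> (\<forall>(W, b)\<in>set ls. W \<in> carrier_mat N N \<and> b \<in> carrier_vec N)"

definition relu :: "real \<Rightarrow> real" where
  "relu t = max t 0"

(* real vec carries no topology; a vector of dimension N is sent to the sequence of its
   coordinates padded by zeros, which is how Euclidean_space N represents N-space. *)
definition vec_to_seq :: "real vec \<Rightarrow> nat \<Rightarrow> real" where
  "vec_to_seq x = (\<lambda>i. if i < dim_vec x then vec_index x i else 0)"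

definition compact_vec_set :: "nat \<Rightarrow> real vec set \<Rightarrow> bool" where
  "compact_vec_set N K \<longleftrightarrow>
     K \<subseteq> carrier_vec N \<and> compactin (Euclidean_space N) (vec_to_seq ` K)"


section \<open>The definitions are well posed\<close>

lemma card_interior_nodes: "card (interior_nodes n) = (n - 1)^2"
  by (simp add: interior_nodes_def power2_eq_square)

lemma finite_interior_nodes: "finite (interior_nodes n)"
  by (simp add: interior_nodes_def)

lemma bij_betw_node_index: "bij_betw (node_index n) (interior_nodes n) {1..(n - 1)^2}"
proof -
  let ?m = "n - 1"
  have inj: "inj_on (node_index n) (interior_nodes n)"
  proof (rule inj_onI)
    fix u v assume u: "u \<in> interior_nodes n" and v: "v \<in> interior_nodes n"
      and eq: "node_index n u = node_index n v"
    have "u = v" if "u \<in> interior_nodes n" "v \<in> interior_nodes n"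
        "node_index n u = node_index n v" "snd u \<le> snd v" for u v
    proof -
      obtain i j p q where [simp]: "u = (i, j)" "v = (p, q)" by fastforce
      have b: "1 \<le> i" "i \<le> ?m" "1 \<le> j" "1 \<le> p" "p \<le> ?m" "1 \<le> q" "j \<le> q"
        and e: "?m * (j - 1) + i = ?m * (q - 1) + p"
        using that by (auto simp: interior_nodes_def node_index_def)
      have "j = q"
      proof (rule ccontr)
        assume "j \<noteq> q"
        then have "?m * (j - 1) + ?m \<le> ?m * (q - 1)"
          using b by (metis Suc_le_eq add.commute diff_less_mono le_neq_implies_less
              mult_Suc_right mult_le_mono2)
        then show False using e b by linarith
      qed
      then show "u = v" using e by simp
    qed
    then show "u = v" using u v eq by (metis nat_le_linear)
  qed
  have "node_index n ` interior_nodes n \<subseteq> {1..?m^2}"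
  proof
    fix k assume "k \<in> node_index n ` interior_nodes n"
    then obtain i j where b: "1 \<le> i" "i \<le> ?m" "1 \<le> j" "j \<le> ?m" and k: "k = ?m * (j - 1) + i"
      by (auto simp: interior_nodes_def node_index_def)
    have "?m * (j - 1) + ?m = ?m * j" using b by (metis Suc_diff_le diff_Suc_1 mult_Suc_right add.commute One_nat_def)
    moreover have "?m * j \<le> ?m * ?m" using b by simp
    ultimately have "k \<le> ?m * ?m" using b(2) unfolding k by linarith
    then show "k \<in> {1..?m^2}" using b k by (simp add: power2_eq_square)
  qed
  moreover have "card (node_index n ` interior_nodes n) = card {1..?m^2}"
    using card_image[OF inj] by (simp add: card_interior_nodes)
  ultimately have "node_index n ` interior_nodes n = {1..?m^2}"
    by (metis card_subset_eq finite_atLeastAtMost)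
  then show ?thesis using inj by (simp add: bij_betw_def)
qed

lemma lower_triangle_eq:
  assumes "n > 0"
  shows "lower_triangle n a b =
    {z. real a \<le> n * fst z \<and> real b \<le> n * snd z \<and> n * fst z + n * snd z \<le> real a + real b + 1}"
    (is "_ = ?R")
proof
  show "lower_triangle n a b \<subseteq> ?R"
  proof
    fix z assume "z \<in> lower_triangle n a b"
    then obtain u v w where uvw: "0 \<le> u" "0 \<le> v" "0 \<le> w" "u + v + w = 1"
      and z: "z = u *\<^sub>R grid_node n (a, b) + v *\<^sub>R grid_node n (a + 1, b) + w *\<^sub>R grid_node n (a, b + 1)"
      unfolding lower_triangle_def convex_hull_3 by blast
    have u: "u = 1 - v - w" using uvw by simp
    have "n * fst z = a + v" "n * snd z = b + w"
      using assms by (simp_all add: z u grid_node_def field_simps)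
    then show "z \<in> ?R" using uvw by simp
  qed
  show "?R \<subseteq> lower_triangle n a b"
  proof
    fix z assume z: "z \<in> ?R"
    define v w where "v = n * fst z - a" and "w = n * snd z - b"
    have "z = (1 - v - w) *\<^sub>R grid_node n (a, b) + v *\<^sub>R grid_node n (a + 1, b) + w *\<^sub>R grid_node n (a, b + 1)"
      using assms by (simp add: prod_eq_iff grid_node_def v_def w_def field_simps)
    moreover have "0 \<le> 1 - v - w" "0 \<le> v" "0 \<le> w" using z by (auto simp: v_def w_def)
    moreover have "1 - v - w + v + w = 1" by simp
    ultimately show "z \<in> lower_triangle n a b"
      unfolding lower_triangle_def convex_hull_3 by blast
  qed
qed

lemma upper_triangle_eq:
  assumes "n > 0"
  shows "upper_triangle n a b =
    {z. n * fst z \<le> real a + 1 \<and> n * snd z \<le> real b + 1 \<and> real a + real b + 1 \<le> n * fst z + n * snd z}"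
    (is "_ = ?R")
proof
  show "upper_triangle n a b \<subseteq> ?R"
  proof
    fix z assume "z \<in> upper_triangle n a b"
    then obtain u v w where uvw: "0 \<le> u" "0 \<le> v" "0 \<le> w" "u + v + w = 1"
      and z: "z = u *\<^sub>R grid_node n (a + 1, b + 1) + v *\<^sub>R grid_node n (a + 1, b) + w *\<^sub>R grid_node n (a, b + 1)"
      unfolding upper_triangle_def convex_hull_3 by blast
    have u: "u = 1 - v - w" using uvw by simp
    have "n * fst z = a + 1 - w" "n * snd z = b + 1 - v"
      using assms by (simp_all add: z u grid_node_def field_simps)
    then show "z \<in> ?R" using uvw by simp
  qed
  show "?R \<subseteq> upper_triangle n a b"
  proof
    fix z assume z: "z \<in> ?R"
    define v w where "v = b + 1 - n * snd z" and "w = a + 1 - n * fst z"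
    have "z = (1 - v - w) *\<^sub>R grid_node n (a + 1, b + 1) + v *\<^sub>R grid_node n (a + 1, b) + w *\<^sub>R grid_node n (a, b + 1)"
      using assms by (simp add: prod_eq_iff grid_node_def v_def w_def field_simps)
    moreover have "0 \<le> 1 - v - w" "0 \<le> v" "0 \<le> w" using z by (auto simp: v_def w_def)
    moreover have "1 - v - w + v + w = 1" by simp
    ultimately show "z \<in> upper_triangle n a b"
      unfolding upper_triangle_def convex_hull_3 by blast
  qed
qed

lemma mesh_covers:
  assumes "n > 0" "z \<in> unit_square"
  obtains a b where "a < n" "b < n" "z \<in> lower_triangle n a b \<or> z \<in> upper_triangle n a b"
proof -
  have *: "\<exists>a<n. real a \<le> n * x \<and> n * x \<le> real a + 1" if "0 \<le> x" "x \<le> 1" for x :: real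
  proof (cases "x = 1")
    case True
    then show ?thesis using assms(1) by (intro exI[of _ "n - 1"]) (auto simp: of_nat_diff)
  next
    case False
    then have "n * x < n" using that assms(1) by simp
    moreover have "0 \<le> n * x" using that by simp
    ultimately have "real (nat \<lfloor>n * x\<rfloor>) \<le> n * x" "n * x < real (nat \<lfloor>n * x\<rfloor>) + 1"
      "nat \<lfloor>n * x\<rfloor> < n" by linarith+
    then show ?thesis by (meson less_eq_real_def)
  qed
  obtain x y where z: "z = (x, y)" "0 \<le> x" "x \<le> 1" "0 \<le> y" "y \<le> 1"
    using assms(2) by (auto simp: unit_square_def)
  obtain a b where ab: "a < n" "real a \<le> n * x" "n * x \<le> real a + 1"
    "b < n" "real b \<le> n * y" "n * y \<le> real b + 1"
    using *[of x] *[of y] z by blast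
  have "z \<in> lower_triangle n a b \<or> z \<in> upper_triangle n a b"
    using ab unfolding lower_triangle_eq[OF assms(1)] upper_triangle_eq[OF assms(1)]
    by (auto simp: z)
  then show thesis using that ab by blast
qed

lemma affine_eq_on_hull:
  fixes f g :: "real \<times> real \<Rightarrow> real"
  assumes "\<exists>c d. \<forall>z\<in>convex hull {p, q, r}. f z = c + inner d z"
    and "\<exists>c d. \<forall>z\<in>convex hull {p, q, r}. g z = c + inner d z"
    and "f p = g p" "f q = g q" "f r = g r" and z: "z \<in> convex hull {p, q, r}"
  shows "f z = g z"
proof -
  obtain u v w where uvw: "u + v + w = 1" and zz: "z = u *\<^sub>R p + v *\<^sub>R q + w *\<^sub>R r"
    using z unfolding convex_hull_3 by blast
  have mem: "p \<in> convex hull {p, q, r}" "q \<in> convex hull {p, q, r}" "r \<in> convex hull {p, q, r}"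
    by (auto intro: hull_inc)
  have comb: "h z = u * h p + v * h q + w * h r"
    if affine: "\<exists>c d. \<forall>z\<in>convex hull {p, q, r}. h z = c + inner d z" for h :: "real \<times> real \<Rightarrow> real"
  proof -
    obtain c d where h: "\<And>z. z \<in> convex hull {p, q, r} \<Longrightarrow> h z = c + inner d z" using affine by blast
    have "h z = c + (u * inner d p + v * inner d q + w * inner d r)"
      by (simp add: h[OF z]) (simp add: zz inner_add_right)
    also have "c = (u + v + w) * c" using uvw by simp
    finally show ?thesis by (simp add: h[OF mem(1)] h[OF mem(2)] h[OF mem(3)] algebra_simps)
  qed
  show ?thesis using comb[OF assms(1)] comb[OF assms(2)] assms(3-5) by simp
qed

lemma nodal_function_unique:
  assumes n: "n > 0" and f: "nodal_function n v f" and g: "nodal_function n v g"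
  shows "f = g"
proof
  fix z
  show "f z = g z"
  proof (cases "z \<in> unit_square")
    case False
    then show ?thesis using f g unfolding nodal_function_def by metis
  next
    case True
    then obtain a b where ab: "a < n" "b < n"
      and z: "z \<in> lower_triangle n a b \<or> z \<in> upper_triangle n a b"
      using mesh_covers[OF n] by blast
    have nodes: "f (grid_node n (i, j)) = g (grid_node n (i, j))" if "i \<le> n" "j \<le> n" for i j
      using f g that by (simp add: nodal_function_def)
    have mesh: "lower_triangle n a b \<in> mesh_triangles n" "upper_triangle n a b \<in> mesh_triangles n"
      using ab by (auto simp: mesh_triangles_def)
    have aff: "\<exists>c d. \<forall>z\<in>T. f z = c + inner d z" "\<exists>c d. \<forall>z\<in>T. g z = c + inner d z"
      if "T \<in> mesh_triangles n" for T
      using f g that by (auto simp: nodal_function_def)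
    from z show ?thesis
    proof
      assume "z \<in> lower_triangle n a b"
      then have "z \<in> convex hull {grid_node n (a, b), grid_node n (a + 1, b), grid_node n (a, b + 1)}"
        by (simp add: lower_triangle_def)
      then show ?thesis using ab
        by (intro affine_eq_on_hull[OF aff[OF mesh(1), unfolded lower_triangle_def] nodes nodes nodes])
          simp_all
    next
      assume "z \<in> upper_triangle n a b"
      then have "z \<in> convex hull {grid_node n (a + 1, b + 1), grid_node n (a + 1, b), grid_node n (a, b + 1)}"
        by (simp add: upper_triangle_def)
      then show ?thesis using ab
        by (intro affine_eq_on_hull[OF aff[OF mesh(2), unfolded upper_triangle_def] nodes nodes nodes])
          simp_all
    qed
  qed
qed

definition hex_fun :: "real \<Rightarrow> real \<Rightarrow> real" where
  "hex_fun s t = max 0 (1 - max (max \<bar>s\<bar> \<bar>t\<bar>) \<bar>s + t\<bar>)"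

definition hat_formula :: "nat \<Rightarrow> nat \<times> nat \<Rightarrow> real \<times> real \<Rightarrow> real" where
  "hat_formula n v z = hex_fun (n * fst z - real (fst v)) (n * snd z - real (snd v))"

lemma hex_fun_outside: "1 \<le> \<bar>s\<bar> \<or> 1 \<le> \<bar>t\<bar> \<or> 1 \<le> \<bar>s + t\<bar> \<Longrightarrow> hex_fun s t = 0"
  unfolding hex_fun_def by linarith

lemma hex_fun_sectors:
  "0 \<le> s \<Longrightarrow> 0 \<le> t \<Longrightarrow> s + t \<le> 1 \<Longrightarrow> hex_fun s t = 1 - s - t"
  "- 1 \<le> s \<Longrightarrow> 0 \<le> t \<Longrightarrow> s + t \<le> 0 \<Longrightarrow> hex_fun s t = 1 + s"
  "0 \<le> s \<Longrightarrow> - 1 \<le> t \<Longrightarrow> s + t \<le> 0 \<Longrightarrow> hex_fun s t = 1 + t"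
  "s \<le> 0 \<Longrightarrow> t \<le> 1 \<Longrightarrow> 0 \<le> s + t \<Longrightarrow> hex_fun s t = 1 - t"
  "s \<le> 1 \<Longrightarrow> t \<le> 0 \<Longrightarrow> 0 \<le> s + t \<Longrightarrow> hex_fun s t = 1 - s"
  "s \<le> 0 \<Longrightarrow> t \<le> 0 \<Longrightarrow> - 1 \<le> s + t \<Longrightarrow> hex_fun s t = 1 + s + t"
  unfolding hex_fun_def by linarith+

lemma hat_formula_affine:
  assumes n: "n > 0" and T: "T \<in> mesh_triangles n"
  shows "\<exists>c d. \<forall>z\<in>T. hat_formula n v z = c + inner d z"
proof -
  obtain i j where v: "v = (i, j)" by fastforce
  have wit: ?thesis
    if "\<And>z. z \<in> T \<Longrightarrow> hex_fun (real n * fst z - real i) (real n * snd z - real j)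
          = c + p * (real n * fst z - real i) + q * (real n * snd z - real j)" for c p q :: real
  proof (rule exI[of _ "c - p * real i - q * real j"], rule exI[of _ "(p * real n, q * real n)"], rule ballI)
    fix z assume "z \<in> T"
    then show "hat_formula n v z = c - p * real i - q * real j + inner (p * real n, q * real n) z"
      using that[of z] by (simp add: hat_formula_def v inner_prod_def algebra_simps)
  qed
  from T obtain a b where
    "T = lower_triangle n a b \<or> T = upper_triangle n a b" by (auto simp: mesh_triangles_def)
  moreover
  have far: "real a + 2 \<le> i \<or> real i + 1 \<le> a \<or> real b + 2 \<le> j \<or> real j + 1 \<le> b"
    if "a + 2 \<le> i \<or> i + 1 \<le> a \<or> b + 2 \<le> j \<or> j + 1 \<le> b" using that by linarith
  consider "i = a" "j = b" | "i = a + 1" "j = b" | "i = a" "j = b + 1" | "i = a + 1" "j = b + 1"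
    | "a + 2 \<le> i \<or> i + 1 \<le> a \<or> b + 2 \<le> j \<or> j + 1 \<le> b" by linarith
  then have ?thesis if "T = lower_triangle n a b"
  proof cases
    case 1 show ?thesis
      by (rule wit[of 1 "-1" "-1"]) (auto simp: that lower_triangle_eq[OF n] 1 hex_fun_sectors(1))
  next
    case 2 show ?thesis
      by (rule wit[of 1 1 0]) (auto simp: that lower_triangle_eq[OF n] 2 hex_fun_sectors(2))
  next
    case 3 show ?thesis
      by (rule wit[of 1 0 1]) (auto simp: that lower_triangle_eq[OF n] 3 hex_fun_sectors(3))
  next
    case 4 show ?thesis
      by (rule wit[of 0 0 0])
        (auto simp: that lower_triangle_eq[OF n] 4 intro!: hex_fun_outside)
  next
    case 5 show ?thesis
    proof (rule wit[of 0 0 0])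
      fix z assume "z \<in> T"
      then have "1 \<le> \<bar>real n * fst z - real i\<bar> \<or> 1 \<le> \<bar>real n * snd z - real j\<bar>"
        using far[OF 5] unfolding that lower_triangle_eq[OF n] by auto
      then show "hex_fun (real n * fst z - real i) (real n * snd z - real j) =
          0 + 0 * (real n * fst z - real i) + 0 * (real n * snd z - real j)"
        using hex_fun_outside by auto
    qed
  qed
  moreover
  consider "i = a" "j = b" | "i = a + 1" "j = b" | "i = a" "j = b + 1" | "i = a + 1" "j = b + 1"
    | "a + 2 \<le> i \<or> i + 1 \<le> a \<or> b + 2 \<le> j \<or> j + 1 \<le> b" by linarith
  then have ?thesis if "T = upper_triangle n a b"
  proof cases
    case 1 show ?thesis
      by (rule wit[of 0 0 0])
        (auto simp: that upper_triangle_eq[OF n] 1 intro!: hex_fun_outside)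
  next
    case 2 show ?thesis
      by (rule wit[of 1 0 "-1"]) (auto simp: that upper_triangle_eq[OF n] 2 hex_fun_sectors(4))
  next
    case 3 show ?thesis
      by (rule wit[of 1 "-1" 0]) (auto simp: that upper_triangle_eq[OF n] 3 hex_fun_sectors(5))
  next
    case 4 show ?thesis
      by (rule wit[of 1 1 1]) (auto simp: that upper_triangle_eq[OF n] 4 hex_fun_sectors(6))
  next
    case 5 show ?thesis
    proof (rule wit[of 0 0 0])
      fix z assume "z \<in> T"
      then have "1 \<le> \<bar>real n * fst z - real i\<bar> \<or> 1 \<le> \<bar>real n * snd z - real j\<bar>"
        using far[OF 5] unfolding that upper_triangle_eq[OF n] by auto
      then show "hex_fun (real n * fst z - real i) (real n * snd z - real j) =
          0 + 0 * (real n * fst z - real i) + 0 * (real n * snd z - real j)"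
        using hex_fun_outside by auto
    qed
  qed
  ultimately show ?thesis by blast
qed

lemma nodal_function_hat_formula:
  assumes n: "n > 0" and v: "v \<in> interior_nodes n"
  shows "nodal_function n v (hat_formula n v)"
  unfolding nodal_function_def
proof (intro conjI ballI allI impI)
  obtain i j where vij: "v = (i, j)" by fastforce
  have ij: "1 \<le> real i" "real i + 1 \<le> n" "1 \<le> real j" "real j + 1 \<le> n"
    using v n by (auto simp: vij interior_nodes_def)
  show "continuous_on unit_square (hat_formula n v)"
    unfolding hat_formula_def hex_fun_def by (intro continuous_intros)
  show "\<exists>c d. \<forall>z\<in>T. hat_formula n v z = c + inner d z" if "T \<in> mesh_triangles n" for T
    by (rule hat_formula_affine[OF n that])
  show "hat_formula n v (grid_node n (p, q)) = (if (p, q) = v then 1 else 0)" for p q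
  proof -
    have e: "hat_formula n v (grid_node n (p, q)) = hex_fun (real p - real i) (real q - real j)"
      using n by (simp add: hat_formula_def grid_node_def vij)
    have "1 \<le> \<bar>real p - real i\<bar> \<or> 1 \<le> \<bar>real q - real j\<bar>" if "(p, q) \<noteq> v"
      using that by (auto simp: vij)
    then show ?thesis unfolding e using hex_fun_outside[of "real p - real i" "real q - real j"]
      by (auto simp: vij hex_fun_def)
  qed
  show "hat_formula n v z = 0" if "z \<notin> unit_square" for z
  proof -
    obtain x y where z: "z = (x, y)" by fastforce
    have out: "x < 0 \<or> 1 < x \<or> y < 0 \<or> 1 < y" using that by (auto simp: unit_square_def z)
    have "n * x < 0" if "x < 0" for x :: real using that n by (simp add: mult_pos_neg)
    moreover have "real n < real n * x" if "1 < x" for x :: real using that n by simp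
    ultimately have "n * x < 0 \<or> real n < n * x \<or> n * y < 0 \<or> real n < n * y" using out by blast
    then have "1 \<le> \<bar>n * x - real i\<bar> \<or> 1 \<le> \<bar>n * y - real j\<bar>" using ij by linarith
    then show ?thesis unfolding hat_formula_def z vij fst_conv snd_conv
      using hex_fun_outside by blast
  qed
qed

lemma ex1_nodal_function:
  assumes "n > 0" "v \<in> interior_nodes n"
  shows "\<exists>!f. nodal_function n v f"
  using nodal_function_hat_formula[OF assms] nodal_function_unique[OF assms(1)] by blast

lemma hat_eq_hat_formula:
  assumes "n > 0" "v \<in> interior_nodes n"
  shows "hat n v = hat_formula n v"
  unfolding hat_def
  by (intro the1_equality ex1_nodal_function nodal_function_hat_formula assms)

lemma patch_Suc_eq:
  "t > 0 \<Longrightarrow> patch n (Suc t) v = (\<Union>w\<in>neighborhood n t v. hat_supp n w)"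
  by (cases t) (auto simp: neighborhood_def)

lemma neighborhood_Suc:
  assumes "t > 0"
  shows "neighborhood n (Suc t) v = (\<Union>w\<in>neighborhood n t v. neighborhood n 1 w)"
proof -
  let ?N = "neighborhood n t v"
  have fin: "finite ?N"
    using finite_interior_nodes by (rule finite_subset[rotated]) (auto simp: neighborhood_def)
  have meas: "hat_supp n u \<inter> hat_supp n w \<in> sets lebesgue" for u w
    by (simp add: hat_supp_def closed_Int lebesgue_closedin)
  have "emeasure lebesgue (hat_supp n u \<inter> patch n (Suc t) v) = 0 \<longleftrightarrow>
        (\<forall>w\<in>?N. emeasure lebesgue (hat_supp n u \<inter> hat_supp n w) = 0)" for u
  proof -
    have eq: "hat_supp n u \<inter> patch n (Suc t) v = (\<Union>w\<in>?N. hat_supp n u \<inter> hat_supp n w)"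
      using assms by (auto simp: patch_Suc_eq)
    have m: "(\<Union>w\<in>?N. hat_supp n u \<inter> hat_supp n w) \<in> sets lebesgue"
      using fin meas by (intro sets.finite_UN) auto
    show ?thesis
    proof
      assume "emeasure lebesgue (hat_supp n u \<inter> patch n (Suc t) v) = 0"
      then show "\<forall>w\<in>?N. emeasure lebesgue (hat_supp n u \<inter> hat_supp n w) = 0"
        unfolding eq using emeasure_mono[OF _ m] by (metis (no_types, lifting) UN_upper le_zero_eq)
    next
      assume *: "\<forall>w\<in>?N. emeasure lebesgue (hat_supp n u \<inter> hat_supp n w) = 0"
      have "(\<Union>w\<in>?N. hat_supp n u \<inter> hat_supp n w) \<in> null_sets lebesgue"
        using * fin meas by (intro null_sets.finite_UN) (auto simp: null_sets_def)
      then show "emeasure lebesgue (hat_supp n u \<inter> patch n (Suc t) v) = 0"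
        unfolding eq by auto
    qed
  qed
  then show ?thesis by (auto simp: neighborhood_def)
qed

lemma neighborhood_sym:
  assumes "t > 0" "v \<in> interior_nodes n" "w \<in> neighborhood n t v"
  shows "v \<in> neighborhood n t w"
proof -
  define R where "R = {(u, w). u \<in> interior_nodes n \<and> w \<in> interior_nodes n \<and>
    emeasure lebesgue (hat_supp n w \<inter> hat_supp n u) \<noteq> 0}"
  have sym: "sym R" by (auto simp: R_def sym_def Int_commute)
  have pow: "w \<in> neighborhood n t v \<longleftrightarrow> (v, w) \<in> R ^^ t"
    if "t > 0" "v \<in> interior_nodes n" for t v w
    using that
  proof (induction t arbitrary: w)
    case (Suc t)
    show ?case
    proof (cases "t = 0")
      case True
      then show ?thesis using Suc.prems by (auto simp: neighborhood_def R_def)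
    next
      case False
      have "w \<in> neighborhood n (Suc t) v \<longleftrightarrow>
          (\<exists>u. u \<in> neighborhood n t v \<and> w \<in> neighborhood n 1 u)"
        using neighborhood_Suc[of t n v] False by blast
      also have "\<dots> \<longleftrightarrow> (\<exists>u. (v, u) \<in> R ^^ t \<and> (u, w) \<in> R)"
        using Suc False by (auto simp: neighborhood_def R_def)
      finally show ?thesis by auto
    qed
  qed simp
  have w: "w \<in> interior_nodes n" using assms(3) by (simp add: neighborhood_def)
  have flip: "(y, x) \<in> R ^^ t" if "(x, y) \<in> R ^^ t" for x y t
    using that
  proof (induction t arbitrary: y)
    case (Suc t)
    then obtain u where "(x, u) \<in> R ^^ t" "(u, y) \<in> R" by auto
    then have "(u, x) \<in> R ^^ t" "(y, u) \<in> R" using Suc.IH sym by (auto dest: symD)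
    then show ?case by (metis relpow_Suc_I2)
  qed simp
  show ?thesis using flip pow assms w by blast
qed

lemma fe_edges_iff:
  assumes "C > 0" "v \<in> interior_nodes n" "w \<in> interior_nodes n"
  shows "{v, w} \<in> fe_edges n C \<longleftrightarrow> v \<noteq> w \<and> w \<in> neighborhood n C v"
proof
  assume "{v, w} \<in> fe_edges n C"
  then obtain a b where "{v, w} = {a, b}" "a \<noteq> b" "b \<in> neighborhood n C a"
    unfolding fe_edges_def by blast
  then consider "a = v" "b = w" | "a = w" "b = v" by (metis doubleton_eq_iff)
  then show "v \<noteq> w \<and> w \<in> neighborhood n C v"
    using \<open>a \<noteq> b\<close> \<open>b \<in> neighborhood n C a\<close> neighborhood_sym assms by cases blast+
next
  assume "v \<noteq> w \<and> w \<in> neighborhood n C v"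
  then show "{v, w} \<in> fe_edges n C" unfolding fe_edges_def using assms by blast
qed

end

(* The finite element graph contains all horizontal and vertical grid edges, because the hat
   functions at the end points of such an edge are both positive at its midpoint; hence it is
   connected. An elementary row addition between adjacent vertices is a sparse matrix, and
   commutators along paths yield the row additions between arbitrary vertices. By Gauss-Jordan
   elimination M is therefore a product of sparse matrices. Biases that shift the bounded set of
   intermediate values into the positive orthant turn this product into a ReLU network. *)
theory Submission
  imports Defs
begin

unbundle no vec_syntax

section \<open>Row operations\<close>

text \<open>On the rows x, y at k, l the steps give (x+y, y), (x+y, -x), (y, -x), (y, x). Hence a
  property stable under scalings and additions of rows is also stable under swaps.\<close>

lemma swaprows_as_row_operations:
  fixes B :: "'a::comm_ring_1 mat"
  assumes "k < dim_row B" "l < dim_row B" "k \<noteq> l"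
  shows "swaprows k l B = multrow l (-1) (addrow 1 k l (addrow (-1) l k (addrow 1 k l B)))"
proof (rule eq_matI)
  let ?R = "multrow l (-1) (addrow 1 k l (addrow (-1) l k (addrow 1 k l B)))"
  fix i j assume "i < dim_row ?R" "j < dim_col ?R"
  then have "i < dim_row B" "j < dim_col B" by simp_all
  moreover consider "i = k" | "i = l" | "i \<noteq> k" "i \<noteq> l" by blast
  ultimately show "swaprows k l B $$ (i, j) = ?R $$ (i, j)" using assms by cases simp_all
qed simp_all

text \<open>The recursion picks its row operations by inspecting \<open>A\<close> alone and applies
  each of them to \<open>B\<close> as well, so \<open>P\<close> travels along the second
  component.\<close>

lemma gauss_jordan_main_row_operations:
  fixes A B :: "'a::field mat"
  assumes mult: "\<And>k a B. k < N \<Longrightarrow> a \<noteq> 0 \<Longrightarrow> B \<in> carrier_mat N N \<Longrightarrow> P B \<Longrightarrow> P (multrow k a B)"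
    and add: "\<And>k l a B. k < N \<Longrightarrow> l < N \<Longrightarrow> k \<noteq> l \<Longrightarrow> B \<in> carrier_mat N N \<Longrightarrow> P B \<Longrightarrow> P (addrow a k l B)"
    and "A \<in> carrier_mat N N" "B \<in> carrier_mat N N" "P B"
  shows "P (snd (gauss_jordan_main A B i j))"
  using assms(3-)
proof (induction A B i j rule: gauss_jordan_main.induct)
  case (1 A B i j)
  note A = "1.prems"(1) and B = "1.prems"(2) and PB = "1.prems"(3)
  have dim: "dim_row A = N" "dim_col A = N" using A by auto
  \<comment> \<open>Clearing a column is a list of additions of multiples of the pivot row i; the
    pivot row itself is never a target, so \<open>add\<close> applies to each entry.\<close>
  have elim: "P (eliminate_entries_rec B i is)"
    if "i < N" "\<And>a k. (a, k) \<in> set is \<Longrightarrow> k < N \<and> k \<noteq> i" for "is"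
    using that B PB
  proof (induction "is" arbitrary: B)
    case (Cons p "is")
    obtain a k where p: "p = (a, k)" by fastforce
    have k: "k < N" "k \<noteq> i" using Cons.prems(2)[of a k] p by auto
    have "P (eliminate_entries_rec (addrow a k i B) i is)"
      using Cons.prems k by (intro Cons.IH) (auto intro: add)
    then show ?case using p by simp
  qed simp
  have swap: "P (swaprows k l B)" if "k < N" "l < N" "k \<noteq> l" for k l
    using that B PB
    by (subst swaprows_as_row_operations) (auto intro!: mult add)
  note step = gauss_jordan_main.simps[of A B i j, unfolded Let_def dim]
  show ?case
  proof (cases "i < N \<and> j < N")
    case False
    then have "gauss_jordan_main A B i j = (A, B)" unfolding step by (simp only: if_False)
    then show ?thesis using PB by simp
  next
    case True
    note IH = "1.IH"[OF dim[symmetric] True refl]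
    let ?v = "\<lambda>i. A $$ (i, j)"
    \<comment> \<open>These are the branches of the algorithm: a zero entry leads to a swap or to
      the next column, a unit pivot clears its column, any other pivot is first scaled to 1.\<close>
    consider "A $$ (i, j) = 0" | "A $$ (i, j) = 1" | "A $$ (i, j) \<noteq> 0" "A $$ (i, j) \<noteq> 1" by blast
    then show ?thesis
    proof cases
      case c: 1
      show ?thesis
      proof (cases "[i'. i' <- [Suc i..<N], A $$ (i', j) \<noteq> 0]")
        case Nil
        then have "gauss_jordan_main A B i j = gauss_jordan_main A B i (Suc j)"
          unfolding step by (simp only: True c simp_thms if_True list.case)
        then show ?thesis using IH(1)[OF c Nil A B PB] by simp
      next
        case (Cons k ks)
        then have "k \<in> set [i'. i' <- [Suc i..<N], A $$ (i', j) \<noteq> 0]" by simp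
        then have k: "k < N" "i \<noteq> k" by auto
        have "gauss_jordan_main A B i j = gauss_jordan_main (swaprows i k A) (swaprows i k B) i j"
          unfolding step by (simp only: True c Cons simp_thms if_True list.case)
        moreover have "P (swaprows i k B)" using swap True k by blast
        ultimately show ?thesis using IH(2)[OF c Cons] A B by simp
      qed
    next
      case c: 2
      have "gauss_jordan_main A B i j =
          gauss_jordan_main (eliminate_entries ?v A i j) (eliminate_entries ?v B i j) (Suc i) (Suc j)"
        unfolding step by (simp only: True c simp_thms if_True if_False zero_neq_one one_neq_zero)
      moreover have "P (eliminate_entries ?v B i j)"
        using True A B by (subst eliminate_entries_convert) (auto intro!: elim)
      ultimately show ?thesis
        using IH(3)[OF _ c refl] A B c by (simp add: carrier_eliminate_entries)
    next
      case c: 3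
      have "gauss_jordan_main A B i j =
          gauss_jordan_main (multrow i (inverse (A $$ (i, j))) A) (multrow i (inverse (A $$ (i, j))) B) i j"
        unfolding step by (simp only: True c simp_thms if_True if_False)
      moreover have "P (multrow i (inverse (A $$ (i, j))) B)" using mult True c B PB by simp
      ultimately show ?thesis using IH(4)[OF c refl] A B by simp
    qed
  qed
qed

text \<open>Elimination runs on the inverse \<open>B\<close> of \<open>M\<close>: the operations
  that reduce \<open>B\<close> to the identity turn the identity into the inverse of
  \<open>B\<close>, which is \<open>M\<close>.\<close>

lemma invertible_mat_row_induct:
  fixes M :: "'a::field mat"
  assumes M: "M \<in> carrier_mat N N" "invertible_mat M"
    and one: "P (1\<^sub>m N)"
    and mult: "\<And>k a B. k < N \<Longrightarrow> a \<noteq> 0 \<Longrightarrow> B \<in> carrier_mat N N \<Longrightarrow> P B \<Longrightarrow> P (multrow k a B)"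
    and add: "\<And>k l a B. k < N \<Longrightarrow> l < N \<Longrightarrow> k \<noteq> l \<Longrightarrow> B \<in> carrier_mat N N \<Longrightarrow> P B \<Longrightarrow> P (addrow a k l B)"
  shows "P M"
proof -
  obtain B where B: "M * B = 1\<^sub>m N" "B * M = 1\<^sub>m (dim_row B)"
    using M unfolding invertible_mat_def inverts_mat_def by auto
  \<comment> \<open>The shape of \<open>B\<close> is not given beforehand; the column counts of the
    two inverse identities determine it.\<close>
  have "dim_row B = N" "dim_col B = N"
    using arg_cong[OF B(1), of dim_col] arg_cong[OF B(2), of dim_col] M by auto
  then have Bc: "B \<in> carrier_mat N N" by auto
  have BU: "B \<in> Units (ring_mat TYPE('a) N ())"
    using B Bc M by (auto simp: Units_def ring_mat_def)
  obtain B' where gj: "gauss_jordan B (1\<^sub>m N) = (1\<^sub>m N, B')"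
    using gauss_jordan_inverse_other_direction[OF BU one_carrier_mat] by (metis prod.collapse)
  note inv = gauss_jordan_compute_inverse[OF Bc gj]
  have "M = M * (B * B')" using inv M by simp
  also have "\<dots> = (M * B) * B'" by (rule assoc_mult_mat[symmetric, OF M(1) Bc inv(3)])
  also have "\<dots> = B'" using B inv by simp
  finally have "M = snd (gauss_jordan_main B (1\<^sub>m N) 0 0)" using gj by (simp add: gauss_jordan_def)
  then show ?thesis
    using gauss_jordan_main_row_operations[of N P B "1\<^sub>m N" 0 0, OF mult add Bc one_carrier_mat one] by simp
qed


section \<open>Products of sparse matrices\<close>

text \<open>The monoid generated by \<open>S\<close>. A new factor is appended on the right, so it
  acts first on a vector and becomes the first layer of the network.\<close>

inductive_set mat_products :: "nat \<Rightarrow> 'a::semiring_1 mat set \<Rightarrow> 'a mat set" for N S where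
  one: "1\<^sub>m N \<in> mat_products N S"
| mult: "A \<in> mat_products N S \<Longrightarrow> W \<in> S \<Longrightarrow> A * W \<in> mat_products N S"

lemma mat_products_carrier:
  assumes "S \<subseteq> carrier_mat N N" "A \<in> mat_products N S"
  shows "A \<in> carrier_mat N N"
  using assms(2) by induction (use assms(1) in auto)

lemma mat_products_mult:
  assumes S: "S \<subseteq> carrier_mat N N" and A: "A \<in> mat_products N S" and B: "B \<in> mat_products N S"
  shows "A * B \<in> mat_products N S"
  using B
proof induction
  case one
  then show ?case using mat_products_carrier[OF S A] A by simp
next
  case (mult B W)
  have "A * (B * W) = (A * B) * W"
    using mat_products_carrier[OF S A] mat_products_carrier[OF S mult.hyps(1)] S mult.hyps(2)
    by (intro assoc_mult_mat[symmetric]) auto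
  then show ?case using mat_products.mult[OF mult.IH mult.hyps(2)] by simp
qed

lemma mat_products_incl:
  assumes "S \<subseteq> carrier_mat N N" "W \<in> S"
  shows "W \<in> mat_products N S"
  using mat_products.mult[OF mat_products.one assms(2), of N] assms by (auto simp: left_mult_one_mat[of _ N N])

text \<open>Counterpart of \<open>graph_sparse\<close> on 0-based indices. \<open>E\<close> is a set
  of ordered pairs, so that paths are plain reflexive transitive closure.\<close>

definition pattern_matrices :: "nat \<Rightarrow> (nat \<times> nat) set \<Rightarrow> 'a::semiring_1 mat set" where
  "pattern_matrices N E =
     {W \<in> carrier_mat N N. \<forall>i<N. \<forall>j<N. i \<noteq> j \<longrightarrow> W $$ (i, j) \<noteq> 0 \<longrightarrow> (i, j) \<in> E}"

lemma pattern_matrices_carrier: "pattern_matrices N E \<subseteq> carrier_mat N N"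
  by (auto simp: pattern_matrices_def)

text \<open>The commutator identity for elementary matrices; it extends row additions from edges to paths.\<close>

lemma addrow_commutator:
  fixes B :: "'a::comm_ring_1 mat"
  assumes "k < dim_row B" "l < dim_row B" "m < dim_row B" "k \<noteq> l" "l \<noteq> m" "k \<noteq> m"
  shows "addrow a k m B = addrow (- a) k l (addrow (-1) l m (addrow a k l (addrow 1 l m B)))"
proof (rule eq_matI)
  let ?R = "addrow (- a) k l (addrow (-1) l m (addrow a k l (addrow 1 l m B)))"
  fix i j assume "i < dim_row ?R" "j < dim_col ?R"
  then have "i < dim_row B" "j < dim_col B" by simp_all
  moreover consider "i = k" | "i = l" | "i \<noteq> k" "i \<noteq> l" by blast
  ultimately show "addrow a k m B $$ (i, j) = ?R $$ (i, j)"
    using assms by cases (simp_all add: algebra_simps)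
qed simp_all

lemma addrow_mat_products:
  fixes a :: "'a::comm_ring_1"
  assumes conn: "(k, l) \<in> (E \<inter> {..<N} \<times> {..<N})\<^sup>*" and k: "k < N" and "k \<noteq> l"
  shows "addrow_mat N a k l \<in> mat_products N (pattern_matrices N E)"
proof -
  let ?Q = "mat_products N (pattern_matrices N E) :: 'a mat set"
  \<comment> \<open>All coefficients are covered at once because the commutator uses both
    \<open>a\<close> and \<open>-a\<close>; the implication allows a path to return to
    \<open>k\<close>.\<close>
  have "l < N \<and> (k \<noteq> l \<longrightarrow> (\<forall>a. addrow_mat N a k l \<in> ?Q))"
    using conn
  proof (induction rule: rtrancl_induct)
    case base
    then show ?case using k by simp
  next
    case (step l m)
    then have lm: "l < N" "m < N" "(l, m) \<in> E" by auto
    have edge: "addrow_mat N a l m \<in> ?Q" if "l \<noteq> m" for a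
      using lm that
      by (intro mat_products_incl pattern_matrices_carrier) (auto simp: pattern_matrices_def)
    have "addrow_mat N a k m \<in> ?Q" if km: "k \<noteq> m" for a
    proof (cases "l = m \<or> k = l")
      \<comment> \<open>The commutator needs three distinct indices. In the degenerate cases the
        induction hypothesis or the edge alone suffices.\<close>
      case True
      then show ?thesis using edge step.IH km by auto
    next
      case False
      have op: "addrow a p q B = addrow_mat N a p q * B"
        if "B \<in> carrier_mat N N" "q < N" for a p q and B :: "'a mat"
        using addrow_mat that by blast
      have one: "addrow_mat N a p q = addrow a p q (1\<^sub>m N)" if "q < N" for a :: 'a and p q
        using op[OF one_carrier_mat that] by (simp add: right_mult_one_mat[of _ N])
      have "addrow_mat N a k m = addrow (- a) k l (addrow (-1) l m (addrow a k l (addrow 1 l m (1\<^sub>m N))))"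
        unfolding one[OF lm(2)] using False km k lm by (intro addrow_commutator) auto
      also have "\<dots> = addrow_mat N (- a) k l * (addrow_mat N (-1) l m * (addrow_mat N a k l * addrow_mat N 1 l m))"
        using lm by (simp add: op right_mult_one_mat[of _ N] mult_carrier_mat[of _ N N])
      also have "\<dots> \<in> ?Q"
        using edge step.IH False by (intro mat_products_mult[OF pattern_matrices_carrier]) auto
      finally show ?thesis .
    qed
    then show ?case using lm by simp
  qed
  then show ?thesis using assms by simp
qed

text \<open>Row operations are left multiplications by elementary matrices: scalings are diagonal
  and fit every pattern, additions are products by connectivity.\<close>

lemma invertible_mat_in_products:
  fixes M :: "'a::field mat"
  assumes M: "M \<in> carrier_mat N N" "invertible_mat M"
    and conn: "\<And>k l. k < N \<Longrightarrow> l < N \<Longrightarrow> (k, l) \<in> (E \<inter> {..<N} \<times> {..<N})\<^sup>*"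
  shows "M \<in> mat_products N (pattern_matrices N E)"
proof (rule invertible_mat_row_induct[OF M, where P = "\<lambda>B. B \<in> mat_products N (pattern_matrices N E)"])
  show "1\<^sub>m N \<in> mat_products N (pattern_matrices N E)" by (rule mat_products.one)
next
  fix k and a :: 'a and B :: "'a mat"
  assume *: "k < N" "B \<in> carrier_mat N N" "B \<in> mat_products N (pattern_matrices N E)"
  have "multrow_mat N k a \<in> mat_products N (pattern_matrices N E)"
    by (intro mat_products_incl pattern_matrices_carrier) (auto simp: pattern_matrices_def split: if_splits)
  then show "multrow k a B \<in> mat_products N (pattern_matrices N E)"
    using * by (simp add: multrow_mat[of B N N] mat_products_mult[OF pattern_matrices_carrier])
next
  fix k l and a :: 'a and B :: "'a mat"
  assume "k < N" "l < N" "k \<noteq> l" "B \<in> carrier_mat N N" "B \<in> mat_products N (pattern_matrices N E)"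
  then show "addrow a k l B \<in> mat_products N (pattern_matrices N E)"
    unfolding addrow_mat[OF \<open>B \<in> carrier_mat N N\<close> \<open>l < N\<close>]
    by (intro mat_products_mult[OF pattern_matrices_carrier] addrow_mat_products conn)
qed


section \<open>ReLU networks on bounded sets\<close>

definition bounded_vec_set :: "nat \<Rightarrow> real vec set \<Rightarrow> bool" where
  "bounded_vec_set N K \<longleftrightarrow> K \<subseteq> carrier_vec N \<and> (\<exists>\<beta>. \<forall>x\<in>K. \<forall>i<N. \<bar>x $ i\<bar> \<le> \<beta>)"

text \<open>Coordinate projections are continuous, so they map \<open>K\<close> to compact, hence
  bounded, sets of reals.\<close>

lemma bounded_vec_set_compact:
  assumes "compact_vec_set N K"
  shows "bounded_vec_set N K"
proof -
  have K: "K \<subseteq> carrier_vec N" and comp: "compactin (Euclidean_space N) (vec_to_seq ` K)"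
    using assms by (auto simp: compact_vec_set_def)
  have "\<exists>\<beta>. \<forall>x\<in>K. \<bar>x $ i\<bar> \<le> \<beta>" if "i < N" for i
  proof -
    have "continuous_map (Euclidean_space N) euclideanreal (\<lambda>x. x i)"
      unfolding Euclidean_space_def
      by (intro continuous_map_from_subtopology continuous_map_product_projection) simp
    then have "compact ((\<lambda>x. x i) ` vec_to_seq ` K)"
      using image_compactin[OF comp] by fastforce
    then have "bounded ((\<lambda>x. x i) ` vec_to_seq ` K)" by (rule compact_imp_bounded)
    then obtain \<beta> where "\<forall>x\<in>K. \<bar>vec_to_seq x i\<bar> \<le> \<beta>"
      by (auto simp: bounded_iff)
    moreover have "vec_to_seq x i = x $ i" if "x \<in> K" for x
      using subsetD[OF K that] \<open>i < N\<close> by (simp add: vec_to_seq_def)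
    ultimately show ?thesis by auto
  qed
  then obtain \<beta> where \<beta>: "\<And>i x. i < N \<Longrightarrow> x \<in> K \<Longrightarrow> \<bar>x $ i\<bar> \<le> \<beta> i" by metis
  \<comment> \<open>The sum dominates every single coordinate bound and, unlike a maximum, also
    makes sense for N = 0.\<close>
  have "\<bar>x $ i\<bar> \<le> (\<Sum>i<N. \<bar>\<beta> i\<bar>)" if "x \<in> K" "i < N" for x i
  proof -
    have "\<bar>x $ i\<bar> \<le> \<bar>\<beta> i\<bar>" using \<beta>[OF that(2,1)] by simp
    also have "\<dots> \<le> (\<Sum>i<N. \<bar>\<beta> i\<bar>)" using that by (intro member_le_sum) auto
    finally show ?thesis .
  qed
  then show ?thesis using K unfolding bounded_vec_set_def by blast
qed

lemma bounded_vec_set_mult: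
  assumes W: "W \<in> carrier_mat N N" and K: "bounded_vec_set N K"
  shows "bounded_vec_set N ((\<lambda>x. W *\<^sub>v x) ` K)"
proof -
  obtain \<beta> where Kc: "K \<subseteq> carrier_vec N" and \<beta>: "\<And>x i. x \<in> K \<Longrightarrow> i < N \<Longrightarrow> \<bar>x $ i\<bar> \<le> \<beta>"
    using K by (auto simp: bounded_vec_set_def)
  have "\<bar>(W *\<^sub>v x) $ i\<bar> \<le> (\<Sum>i<N. \<Sum>j<N. \<bar>W $$ (i, j)\<bar> * \<bar>\<beta>\<bar>)" if x: "x \<in> K" and i: "i < N" for x i
  proof -
    have "dim_vec x = N" using x Kc by auto
    then have "(W *\<^sub>v x) $ i = (\<Sum>j<N. W $$ (i, j) * x $ j)"
      using W i by (auto simp: scalar_prod_def lessThan_atLeast0)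
    then have "\<bar>(W *\<^sub>v x) $ i\<bar> \<le> (\<Sum>j<N. \<bar>W $$ (i, j) * x $ j\<bar>)" by (simp add: sum_abs)
    also have "\<dots> \<le> (\<Sum>j<N. \<bar>W $$ (i, j)\<bar> * \<bar>\<beta>\<bar>)"
      using \<beta>[OF x] unfolding abs_mult by (intro sum_mono mult_left_mono) fastforce+
    also have "\<dots> \<le> (\<Sum>i<N. \<Sum>j<N. \<bar>W $$ (i, j)\<bar> * \<bar>\<beta>\<bar>)"
      using i by (intro member_le_sum[of i "{..<N}" "\<lambda>i. \<Sum>j<N. \<bar>W $$ (i, j)\<bar> * \<bar>\<beta>\<bar>"]) (auto intro: sum_nonneg)
    finally show ?thesis .
  qed
  then show ?thesis using W Kc unfolding bounded_vec_set_def by fastforce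
qed

lemma bounded_vec_set_translate:
  assumes c: "c \<in> carrier_vec N" and K: "bounded_vec_set N K"
  shows "bounded_vec_set N ((\<lambda>x. x + c) ` K)"
proof -
  obtain \<beta> where Kc: "K \<subseteq> carrier_vec N" and \<beta>: "\<And>x i. x \<in> K \<Longrightarrow> i < N \<Longrightarrow> \<bar>x $ i\<bar> \<le> \<beta>"
    using K by (auto simp: bounded_vec_set_def)
  have "\<bar>(x + c) $ i\<bar> \<le> \<beta> + (\<Sum>i<N. \<bar>c $ i\<bar>)" if x: "x \<in> K" and i: "i < N" for x i
  proof -
    have "\<bar>c $ i\<bar> \<le> (\<Sum>i<N. \<bar>c $ i\<bar>)" using i by (intro member_le_sum) auto
    then show ?thesis using \<beta>[OF x i] c i by (simp add: index_add_vec)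
  qed
  then show ?thesis using c Kc unfolding bounded_vec_set_def by fastforce
qed

text \<open>A large constant bias keeps all arguments of ReLU nonnegative on the bounded set; its effect
  is undone in the later layers, so the induction has to allow an arbitrary final translation.\<close>

lemma relu_network_product:
  assumes S: "S \<subseteq> carrier_mat N N" "1\<^sub>m N \<in> S" and A: "A \<in> mat_products N S"
    and "bounded_vec_set N K" "d \<in> carrier_vec N"
  shows "\<exists>ls. network_layers N ls \<and> (\<forall>(W, b)\<in>set ls. W \<in> S) \<and>
           (\<forall>x\<in>K. network_fun relu ls x = A *\<^sub>v x + d)"
  using A assms(4-)
proof (induction arbitrary: K d)
  case one
  \<comment> \<open>The empty product still needs one layer; as the last layer it has no activation,
    and its bias supplies \<open>d\<close>.\<close>
  then show ?case using S by (intro exI[of _ "[(1\<^sub>m N, d)]"]) (simp add: network_layers_def)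
next
  case (mult A W)
  have W: "W \<in> carrier_mat N N" and A: "A \<in> carrier_mat N N"
    using S mult.hyps mat_products_carrier by auto
  have Kc: "K \<subseteq> carrier_vec N" using mult.prems by (simp add: bounded_vec_set_def)
  have WK: "bounded_vec_set N ((\<lambda>x. W *\<^sub>v x) ` K)"
    by (rule bounded_vec_set_mult[OF W mult.prems(1)])
  then obtain \<gamma> where \<gamma>: "\<And>x i. x \<in> K \<Longrightarrow> i < N \<Longrightarrow> \<bar>(W *\<^sub>v x) $ i\<bar> \<le> \<gamma>"
    unfolding bounded_vec_set_def by fastforce
  define c where "c = vec N (\<lambda>_. \<gamma>)"
  have c: "c \<in> carrier_vec N" by (simp add: c_def)
  \<comment> \<open>The remaining layers turn the shift \<open>c\<close> into \<open>A c\<close>,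
    which the new target translation subtracts.\<close>
  let ?d = "d - A *\<^sub>v c"
  have "?d \<in> carrier_vec N" using mult.prems A c by simp
  then obtain ls where ls: "network_layers N ls" "\<forall>(W, b)\<in>set ls. W \<in> S"
    and net: "\<And>x. x \<in> K \<Longrightarrow> network_fun relu ls (W *\<^sub>v x + c) = A *\<^sub>v (W *\<^sub>v x + c) + ?d"
    using mult.IH[OF bounded_vec_set_translate[OF c WK], of ?d] unfolding ball_simps image_image by blast
  \<comment> \<open>Only when another layer follows does \<open>network_fun\<close> apply the
    activation after \<open>(W, c)\<close>.\<close>
  obtain l ls' where ls': "ls = l # ls'" using ls by (cases ls) (auto simp: network_layers_def)
  have "network_fun relu ((W, c) # ls) x = (A * W) *\<^sub>v x + d" if x: "x \<in> K" for x
  proof -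
    have xc: "x \<in> carrier_vec N" using x Kc by auto
    have "map_vec relu (W *\<^sub>v x + c) = W *\<^sub>v x + c"
    proof (rule eq_vecI)
      fix i assume "i < dim_vec (W *\<^sub>v x + c)"
      then have i: "i < N" using c by simp
      then have "0 \<le> (W *\<^sub>v x + c) $ i" using \<gamma>[OF x i] c by (simp add: c_def)
      then show "map_vec relu (W *\<^sub>v x + c) $ i = (W *\<^sub>v x + c) $ i"
        using i c by (simp add: relu_def)
    qed simp
    then have "network_fun relu ((W, c) # ls) x = A *\<^sub>v (W *\<^sub>v x + c) + ?d"
      using net[OF x] ls' by simp
    also have "\<dots> = (A *\<^sub>v (W *\<^sub>v x) + A *\<^sub>v c) + ?d"
      using A W c xc by (simp add: mult_add_distrib_mat_vec[of _ N N])
    also have "\<dots> = A *\<^sub>v (W *\<^sub>v x) + d"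
      using A W c xc mult.prems(2) by (intro eq_vecI) auto
    also have "\<dots> = (A * W) *\<^sub>v x + d" using A W xc by (simp add: assoc_mult_mat_vec[of _ N N])
    finally show ?thesis .
  qed
  then show ?case using ls W c mult.hyps by (intro exI[of _ "(W, c) # ls"]) (auto simp: network_layers_def)
qed


section \<open>Connectivity of the finite element graph\<close>

text \<open>By continuity both hats are nonzero on an open set around \<open>z\<close>, which lies
  in both supports and has positive measure.\<close>

lemma hat_supports_overlap:
  assumes n: "n > 0" and v: "v \<in> interior_nodes n" and w: "w \<in> interior_nodes n"
    and z: "hat_formula n v z \<noteq> 0" "hat_formula n w z \<noteq> 0"
  shows "w \<in> neighborhood n 1 v"
proof -
  let ?U = "{z. hat_formula n v z \<noteq> 0} \<inter> {z. hat_formula n w z \<noteq> 0}"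
  have cont: "continuous_on UNIV (hat_formula n u)" for u
    unfolding hat_formula_def hex_fun_def by (intro continuous_intros)
  have "open ?U"
    by (intro open_Int open_Collect_neq cont continuous_on_const)
  then have nn: "\<not> negligible ?U" using z open_not_negligible by blast
  have "?U \<subseteq> hat_supp n w \<inter> hat_supp n v"
    unfolding hat_supp_def hat_eq_hat_formula[OF n v] hat_eq_hat_formula[OF n w]
    by (intro Int_greatest) (use closure_subset in fastforce)+
  then have "\<not> negligible (hat_supp n w \<inter> hat_supp n v)" using nn negligible_subset by blast
  \<comment> \<open>Since \<open>emeasure\<close> is 0 by default outside the measurable sets,
    measurability is needed to pass from non-negligible to nonzero measure.\<close>
  moreover have "hat_supp n w \<inter> hat_supp n v \<in> sets lebesgue"
    by (simp add: hat_supp_def closed_Int lebesgue_closedin)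
  ultimately have "emeasure lebesgue (hat_supp n w \<inter> hat_supp n v) \<noteq> 0"
    by (auto simp: negligible_iff_null_sets null_sets_def)
  then show ?thesis using w by (simp add: neighborhood_def)
qed

lemma neighborhood_refl:
  assumes "n > 0" "v \<in> interior_nodes n"
  shows "v \<in> neighborhood n 1 v"
  using assms
  by (intro hat_supports_overlap[of _ _ _ "grid_node n v"])
     (auto simp: hat_formula_def grid_node_def hex_fun_def)

text \<open>Every node is its own neighbor, so level-1 neighbors persist to all higher levels; edges
  need only be found at level 1.\<close>

lemma neighborhood_one_subset:
  assumes n: "n > 0" and "t > 0" and v: "v \<in> interior_nodes n"
  shows "neighborhood n 1 v \<subseteq> neighborhood n t v"
  using \<open>t > 0\<close>
proof (induction t rule: nat_induct_non_zero)
  case (Suc t)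
  have "w \<in> neighborhood n 1 w" if "w \<in> neighborhood n 1 v" for w
    using that neighborhood_refl[OF n] by (simp add: neighborhood_def)
  then show ?case using Suc neighborhood_Suc[OF Suc.hyps] by blast
qed simp

lemma fe_edge_grid_neighbors:
  assumes n: "n > 0" and C: "C > 0" and v: "v \<in> interior_nodes n" and w: "w \<in> interior_nodes n"
    and "w = (Suc (fst v), snd v) \<or> w = (fst v, Suc (snd v))"
  shows "{v, w} \<in> fe_edges n C"
proof -
  obtain i j where vij: "v = (i, j)" by fastforce
  from assms(5) have "w \<in> neighborhood n 1 v"
  proof
    assume weq: "w = (Suc (fst v), snd v)"
    show ?thesis
      \<comment> \<open>At the midpoint of the grid edge both hats have the value 1/2.\<close>
      by (rule hat_supports_overlap[OF n v w, of "((real i + 1/2) / n, real j / n)"])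
        (use n in \<open>simp_all add: vij weq hat_formula_def hex_fun_def\<close>)
  next
    assume weq: "w = (fst v, Suc (snd v))"
    show ?thesis
      by (rule hat_supports_overlap[OF n v w, of "(real i / n, (real j + 1/2) / n)"])
        (use n in \<open>simp_all add: vij weq hat_formula_def hex_fun_def\<close>)
  qed
  then show ?thesis
    using neighborhood_one_subset[OF n C v] fe_edges_iff[OF C v w] assms(5) by (auto simp: vij)
qed

text \<open>Every node is reached from the corner (1, 1) by going up the first column and then along
  a row; two nodes are joined through this corner.\<close>

lemma fe_graph_connected:
  assumes n: "n > 0" and C: "C > 0" and v: "v \<in> interior_nodes n" and w: "w \<in> interior_nodes n"
  defines "R \<equiv> {(u, u'). u \<in> interior_nodes n \<and> u' \<in> interior_nodes n \<and> {u, u'} \<in> fe_edges n C}"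
  shows "(v, w) \<in> R\<^sup>*"
proof -
  have R: "(u, u') \<in> R"
    if "u \<in> interior_nodes n" "u' \<in> interior_nodes n" "u' = (Suc (fst u), snd u) \<or> u' = (fst u, Suc (snd u))" for u u'
    using fe_edge_grid_neighbors[OF n C that] that by (simp add: R_def)
  have horizontal: "((1, j), (Suc i, j)) \<in> R\<^sup>*" if "Suc i < n" "1 \<le> j" "j < n" for i j
    using that
  proof (induction i)
    case (Suc i)
    have "((Suc i, j), (Suc (Suc i), j)) \<in> R" using Suc.prems by (intro R) (auto simp: interior_nodes_def)
    then show ?case using Suc by (meson Suc_lessD rtrancl.rtrancl_into_rtrancl)
  qed simp
  have vertical: "((1, 1), (1, Suc j)) \<in> R\<^sup>*" if "Suc j < n" for j
    using that
  proof (induction j)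
    case (Suc j)
    have "((1, Suc j), (1, Suc (Suc j))) \<in> R" using Suc.prems by (intro R) (auto simp: interior_nodes_def)
    then show ?case using Suc by (meson Suc_lessD rtrancl.rtrancl_into_rtrancl)
  qed simp
  have from_corner: "((1, 1), u) \<in> R\<^sup>*" if u: "u \<in> interior_nodes n" for u
  proof -
    obtain i j where uij: "u = (Suc i, Suc j)" "Suc i < n" "Suc j < n"
      using u n by (cases u; cases "fst u"; cases "snd u") (auto simp: interior_nodes_def)
    have "((1, 1), (1, Suc j)) \<in> R\<^sup>*" "((1, Suc j), u) \<in> R\<^sup>*"
      using vertical[of j] horizontal[of i "Suc j"] uij by simp_all
    then show ?thesis by (rule rtrancl_trans)
  qed
  \<comment> \<open>Edges are undirected, so the walk from the corner to \<open>v\<close> can be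
    reversed.\<close>
  have "sym R" by (auto simp: R_def sym_def insert_commute)
  then have "(v, (1, 1)) \<in> R\<^sup>*" using from_corner[OF v] sym_rtrancl symD by metis
  then show ?thesis using from_corner[OF w] by (rule rtrancl_trans)
qed

section \<open>Transfer between grid nodes and matrix indices\<close>

theorem theorem4p14:
  fixes n C :: nat and M :: "real mat" and K :: "real vec set"
  assumes "n \<ge> 2" and "C \<ge> 1"
    and "M \<in> carrier_mat ((n - 1)^2) ((n - 1)^2)" and "invertible_mat M"
    and "K \<noteq> {}" and "compact_vec_set ((n - 1)^2) K"
  shows "\<exists>ls. network_layers ((n - 1)^2) ls \<and>
           (\<forall>(W, b)\<in>set ls. graph_sparse (interior_nodes n) (fe_edges n C) (node_index n) W) \<and>
           (\<forall>x\<in>K. network_fun relu ls x = M *\<^sub>v x)"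
proof -
  let ?N = "(n - 1)^2" and ?V = "interior_nodes n" and ?idx = "\<lambda>v. node_index n v - 1"
  have nC: "n > 0" "C > 0" using assms by auto
  define R where "R = {(u, v). u \<in> ?V \<and> v \<in> ?V \<and> {u, v} \<in> fe_edges n C}"
  define E where "E = (\<lambda>(u, v). (?idx u, ?idx v)) ` R"
  have bij: "bij_betw ?idx ?V {..<?N}"
  proof -
    \<comment> \<open>Shift from the node numbering, which starts at 1, to matrix indices, which
      start at 0.\<close>
    have "bij_betw (\<lambda>k. k - 1) {1..?N} {..<?N}"
      by (rule bij_betw_byWitness[where f' = Suc]) auto
    from bij_betw_trans[OF bij_betw_node_index this] show ?thesis by (simp add: comp_def)
  qed
  have lt: "?idx v < ?N" if "v \<in> ?V" for v using bij_betwE[OF bij] that by auto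
  have conn: "(k, l) \<in> (E \<inter> {..<?N} \<times> {..<?N})\<^sup>*" if kl: "k < ?N" "l < ?N" for k l
  proof -
    obtain v w where vw: "v \<in> ?V" "w \<in> ?V" "k = ?idx v" "l = ?idx w"
      using kl bij unfolding bij_betw_def by (metis (no_types, lifting) imageE lessThan_iff)
    have "(v, w) \<in> R\<^sup>*" using fe_graph_connected[OF nC vw(1,2)] unfolding R_def .
    then have "(?idx v, ?idx w) \<in> (E \<inter> {..<?N} \<times> {..<?N})\<^sup>*"
    proof induction
      case (step u u')
      have "(?idx u, ?idx u') \<in> E \<inter> {..<?N} \<times> {..<?N}"
        using step.hyps(2) lt by (auto simp: E_def R_def)
      then show ?case using step.IH by (rule rtrancl.rtrancl_into_rtrancl[rotated])
    qed simp
    then show ?thesis using vw by simp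
  qed
  have sparse: "graph_sparse ?V (fe_edges n C) (node_index n) W" if W: "W \<in> pattern_matrices ?N E" for W
    unfolding graph_sparse_def
  proof (intro conjI ballI impI)
    show "W \<in> carrier_mat (card ?V) (card ?V)"
      using W pattern_matrices_carrier by (auto simp: card_interior_nodes)
  next
    fix u v assume uv: "u \<in> ?V" "v \<in> ?V" "u \<noteq> v" and nz: "W $$ (?idx u, ?idx v) \<noteq> 0"
    \<comment> \<open>Injectivity traces an index pair in \<open>E\<close> back to the one pair of
      nodes it came from, so the edge found is really \<open>{u, v}\<close>.\<close>
    have inj: "inj_on ?idx ?V" using bij by (simp add: bij_betw_def)
    then have "?idx u \<noteq> ?idx v" using uv by (meson inj_onD)
    then have "(?idx u, ?idx v) \<in> E" using W uv nz lt by (simp add: pattern_matrices_def)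
    then obtain u' v' where *: "(u', v') \<in> R" "?idx u = ?idx u'" "?idx v = ?idx v'"
      unfolding E_def by auto
    then have "u = u'" "v = v'" using inj uv by (auto simp: R_def dest: inj_onD)
    then show "{u, v} \<in> fe_edges n C" using * by (simp add: R_def)
  qed
  have M: "M \<in> mat_products ?N (pattern_matrices ?N E)"
    by (rule invertible_mat_in_products[OF assms(3,4) conn])
  have one: "1\<^sub>m ?N \<in> pattern_matrices ?N E" by (simp add: pattern_matrices_def)
  obtain ls where ls: "network_layers ?N ls" "\<forall>(W, b)\<in>set ls. W \<in> pattern_matrices ?N E"
    and net: "\<And>x. x \<in> K \<Longrightarrow> network_fun relu ls x = M *\<^sub>v x + 0\<^sub>v ?N"
    using relu_network_product[OF pattern_matrices_carrier one M bounded_vec_set_compact[OF assms(6)] zero_carrier_vec]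
    by blast
  have "network_fun relu ls x = M *\<^sub>v x" if "x \<in> K" for x
    using net[OF that] right_zero_vec[OF mult_mat_vec_carrier, of M ?N ?N x] assms(3,6) that
    by (auto simp: compact_vec_set_def)
  then show ?thesis using ls sparse by (intro exI[of _ ls]) fast
qed

end
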